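(* Let $P$ be a directed poset. Then every topological group $G$ with a $P$-base satisfies $$\chi(G)\in\{1,\omega\}\cup[\mathrm{fi}(P),\mathrm{cof}(P)],$$ where $[\mathrm{fi}(P),\mathrm{cof}(P)]$ denotes the interval of cardinals $\kappa$ with $\mathrm{fi}(P)\le\kappa\le\mathrm{cof}(P)$.
   Context: All topological groups are Hausdorff. A pre-ordered set $(P,\le)$ ($\le$ reflexive and transitive; a poset if also antisymmetric) is directed if it is (as usual) nonempty and any two elements have a common upper bound. A set $A\subseteq P$ is dominated by $B\subseteq P$ if for every $a\in A$ there is $b\in B$ with $a\le b$; $A$ is cofinal if $P$ is dominated by $A$. The cofinality $\mathrm{cof}(P)$ is the least cardinality of a cofinal subset of $P$. A directed pre-ordered set $P$ is $\kappa$-fine (for a cardinal $\kappa$) if every $A\subseteq P$ with $|A|\le\kappa$ is dominated by a countable subset of $P$. The fineness index $\mathrm{fi}(P)$ is: the least cardinal $\lambda$ such that $P$ is not $\lambda$-fine, if $\mathrm{cof}(P)>\omega$; $\mathrm{fi}(P)=1$ if $\mathrm{cof}(P)=1$; $\mathrm{fi}(P)=\omega$ if $\mathrm{cof}(P)=\omega$. For a topological group $G$ with identity $e$, $\mathcal N_e(G)$ is the filter of neighbourhoods of $e$, ordered by reverse inclusion. $G$ has a $P$-base if there is an order-preserving map $P\to\mathcal N_e(G)$ with cofinal image. The character $\chi(G)$ is the least cardinality of a neighbourhood base at $e$, i.e. $\chi(G)=\mathrm{cof}(\mathcal N_e(G))$ (so $\chi(G)=1$ when $G$ is discrete). *)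

theory Defs
  imports Complex_Main "HOL-Library.Countable_Set"
begin

unbundle cardinal_syntax

text \<open>
  A pre-ordered set is a carrier \<open>P\<close> together with a relation \<open>r\<close> satisfying
  \<^const>\<open>preorder_on\<close>, where \<open>(p, q) \<in> r\<close> means \<open>p \<le> q\<close>. Cardinals are cardinal orders in the
  sense of \<^const>\<open>Card_order\<close>, compared (across types) by \<open>\<le>o\<close>, \<open><o\<close> and \<open>=o\<close>; the cardinal
  \<open>\<omega>\<close> is \<^const>\<open>natLeq\<close>.
\<close>

definition directed_on :: "'p set \<Rightarrow> 'p rel \<Rightarrow> bool" where
  "directed_on P r \<longleftrightarrow> P \<noteq> {} \<and> (\<forall>x\<in>P. \<forall>y\<in>P. \<exists>z\<in>P. (x, z) \<in> r \<and> (y, z) \<in> r)"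

definition dominated_by :: "'p rel \<Rightarrow> 'p set \<Rightarrow> 'p set \<Rightarrow> bool" where
  "dominated_by r A B \<longleftrightarrow> (\<forall>a\<in>A. \<exists>b\<in>B. (a, b) \<in> r)"

text \<open>The library's \<^const>\<open>cofinal\<close> asks for strict upper bounds, so it is not usable here.\<close>

definition cofinal_in :: "'p set \<Rightarrow> 'p rel \<Rightarrow> 'p set \<Rightarrow> bool" where
  "cofinal_in P r A \<longleftrightarrow> A \<subseteq> P \<and> dominated_by r P A"

definition cof :: "'p set \<Rightarrow> 'p rel \<Rightarrow> 'p rel" where
  "cof P r = |SOME A. cofinal_in P r A \<and> (\<forall>B. cofinal_in P r B \<longrightarrow> |A| \<le>o |B| )|"

definition is_fine :: "'k rel \<Rightarrow> 'p set \<Rightarrow> 'p rel \<Rightarrow> bool" where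
  "is_fine \<kappa> P r \<longleftrightarrow>
     (\<forall>A\<subseteq>P. |A| \<le>o \<kappa> \<longrightarrow> (\<exists>B\<subseteq>P. countable B \<and> dominated_by r A B))"

text \<open>
  The cofinality of a directed set is 1, \<open>\<omega>\<close> or uncountable. In the first two cases the fineness
  index is by definition 1, respectively \<open>\<omega>\<close>, i.e. the cofinality itself. In the last case the
  least cardinal is taken among those represented on the type of \<open>P\<close>; lemma \<open>fi_least\<close> below
  shows that it is then least among all cardinals.
\<close>

definition fi :: "'p set \<Rightarrow> 'p rel \<Rightarrow> 'p rel" where
  "fi P r =
     (if natLeq <o cof P r
      then SOME c :: 'p rel. Card_order c \<and> \<not> is_fine c P r \<and>
             (\<forall>d :: 'p rel. Card_order d \<and> \<not> is_fine d P r \<longrightarrow> c \<le>o d)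
      else cof P r)"

text \<open>
  Groups are written additively (\<^class>\<open>topological_group_add\<close> does not assume commutativity), so
  the identity is \<open>0\<close>. Neighbourhoods need not be open.
\<close>

definition nbhds0 :: "'g::topological_group_add itself \<Rightarrow> 'g set set" where
  "nbhds0 _ = {U. \<exists>V. open V \<and> 0 \<in> V \<and> V \<subseteq> U}"

definition nbhds0_rel :: "'g::topological_group_add itself \<Rightarrow> 'g set rel" where
  "nbhds0_rel G = {(U, V). U \<in> nbhds0 G \<and> V \<in> nbhds0 G \<and> V \<subseteq> U}"

definition has_base :: "'g::topological_group_add itself \<Rightarrow> 'p set \<Rightarrow> 'p rel \<Rightarrow> bool" where
  "has_base G P r \<longleftrightarrow>
     (\<exists>f. f ` P \<subseteq> nbhds0 G \<and>
          (\<forall>p\<in>P. \<forall>q\<in>P. (p, q) \<in> r \<longrightarrow> (f p, f q) \<in> nbhds0_rel G) \<and>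
          cofinal_in (nbhds0 G) (nbhds0_rel G) (f ` P))"

definition character :: "'g::topological_group_add itself \<Rightarrow> 'g set rel" where
  "character G = cof (nbhds0 G) (nbhds0_rel G)"


subsection \<open>The choices in \<open>cof\<close> and \<open>fi\<close> are realised\<close>

lemma cof_least:
  assumes "preorder_on P r"
  shows "\<exists>A. cofinal_in P r A \<and> cof P r = |A|"
    and "cofinal_in P r B \<Longrightarrow> cof P r \<le>o |B|"
proof -
  have "cofinal_in P r P"
    using assms by (auto simp: cofinal_in_def dominated_by_def preorder_on_def refl_on_def)
  then have "\<exists>c \<in> card_of ` Collect (cofinal_in P r). \<forall>c' \<in> card_of ` Collect (cofinal_in P r). c \<le>o c'"
    by (intro exists_minim_Card_order) (auto simp: card_of_Card_order)
  then have "\<exists>A. cofinal_in P r A \<and> (\<forall>B. cofinal_in P r B \<longrightarrow> |A| \<le>o |B| )"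
    by auto
  from someI_ex[OF this]
  show "\<exists>A. cofinal_in P r A \<and> cof P r = |A|"
    and "cofinal_in P r B \<Longrightarrow> cof P r \<le>o |B|"
    unfolding cof_def by blast+
qed

lemma cof_directed_cases:
  assumes "preorder_on P r" "directed_on P r"
  shows "cof P r =o |{()}| \<or> cof P r =o natLeq \<or> natLeq <o cof P r"
proof -
  obtain A where A: "cofinal_in P r A" "cof P r = |A|"
    using cof_least(1)[OF assms(1)] by blast
  have ne: "A \<noteq> {}"
    using A(1) assms(2) by (auto simp: cofinal_in_def dominated_by_def directed_on_def)
  have tr: "trans r"
    using assms(1) by (simp add: preorder_on_def)
  show ?thesis
  proof (cases "finite A")
    case True
    have "F \<subseteq> P \<Longrightarrow> \<exists>z\<in>P. \<forall>x\<in>F. (x, z) \<in> r" if "finite F" for F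
      using that
    proof (induction F)
      case empty
      then show ?case using assms(2) by (auto simp: directed_on_def)
    next
      case (insert x F)
      then obtain y where y: "y \<in> P" "\<forall>u\<in>F. (u, y) \<in> r" by auto
      with insert.prems assms(2) obtain z where "z \<in> P" "(x, z) \<in> r" "(y, z) \<in> r"
        unfolding directed_on_def by blast
      moreover have "(u, z) \<in> r" if "u \<in> F" for u
        using y(2) that \<open>(y, z) \<in> r\<close> transD[OF tr] by blast
      ultimately show ?case by auto
    qed
    with True A(1) obtain z where z: "z \<in> P" "\<forall>x\<in>A. (x, z) \<in> r"
      unfolding cofinal_in_def by blast
    then have "cofinal_in P r {z}"
      using A(1) tr unfolding cofinal_in_def dominated_by_def by (auto; meson transD)
    from cof_least(2)[OF assms(1) this] have "|A| \<le>o |{z}|" by (simp add: A)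
    moreover have "|{z}| \<le>o |{()}|"
      by (intro card_of_ordLeqI[of "\<lambda>_. ()"]) auto
    ultimately have "cof P r \<le>o |{()}|"
      by (metis A(2) ordLeq_transitive)
    moreover have "|{()}| \<le>o cof P r"
      unfolding A(2) using ne by (intro card_of_singl_ordLeq)
    ultimately show ?thesis by (simp add: ordIso_iff_ordLeq)
  next
    case False
    then have "natLeq \<le>o |A|"
      using ordIso_ordLeq_trans[OF ordIso_symmetric[OF card_of_nat]]
      by (simp add: infinite_iff_card_of_nat)
    then show ?thesis
      unfolding A(2) ordLeq_iff_ordLess_or_ordIso using ordIso_symmetric[of natLeq "|A|"] by blast
  qed
qed

lemma fi_eq_one: "cof P r =o |{()}| \<Longrightarrow> fi P r =o |{()}|"
proof -
  assume a: "cof P r =o |{()}|"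
  have "|{()}| \<le>o natLeq"
    by (rule ordLeq_ordIso_trans[OF card_of_singl_ordLeq[of "UNIV :: nat set"] card_of_nat]) simp
  with a have "\<not> natLeq <o cof P r"
    by (meson not_ordLess_ordLeq ordIso_ordLeq_trans)
  with a show ?thesis by (simp add: fi_def)
qed

lemma fi_eq_omega: "cof P r =o natLeq \<Longrightarrow> fi P r =o natLeq"
  unfolding fi_def using not_ordLess_ordIso[of natLeq "cof P r"] ordIso_symmetric[of "cof P r" natLeq] by auto

lemma fi_least:
  fixes P :: "'p set"
  assumes "preorder_on P r" "natLeq <o cof P r"
  shows "Card_order (fi P r)" "\<not> is_fine (fi P r) P r"
    and "Card_order (\<kappa> :: 'k rel) \<Longrightarrow> \<not> is_fine \<kappa> P r \<Longrightarrow> fi P r \<le>o \<kappa>"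
proof -
  have "\<not> is_fine (card_of P) P r"
  proof
    assume "is_fine (card_of P) P r"
    then obtain B where B: "B \<subseteq> P" "countable B" "dominated_by r P B"
      unfolding is_fine_def using ordLeq_refl[OF card_of_Card_order[of P]] by auto
    then have "cof P r \<le>o |B|"
      using cof_least(2)[OF assms(1)] by (simp add: cofinal_in_def)
    moreover obtain g :: "'p \<Rightarrow> nat" where "inj_on g B"
      using B(2) by (auto simp: countable_def)
    then have "|B| \<le>o |UNIV :: nat set|"
      by (rule card_of_ordLeqI) simp
    then have "|B| \<le>o natLeq"
      by (rule ordLeq_ordIso_trans[OF _ card_of_nat])
    ultimately show False
      using not_ordLess_ordLeq[OF assms(2)] ordLeq_transitive by blast
  qed
  then have "\<exists>c \<in> {c :: 'p rel. Card_order c \<and> \<not> is_fine c P r}.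
      \<forall>d \<in> {c :: 'p rel. Card_order c \<and> \<not> is_fine c P r}. c \<le>o d"
    using card_of_Card_order by (intro exists_minim_Card_order) auto
  then have "\<exists>c :: 'p rel. Card_order c \<and> \<not> is_fine c P r \<and>
      (\<forall>d :: 'p rel. Card_order d \<and> \<not> is_fine d P r \<longrightarrow> c \<le>o d)" by auto
  note ex = someI_ex[OF this]
  have fi: "fi P r = (SOME c :: 'p rel. Card_order c \<and> \<not> is_fine c P r \<and>
             (\<forall>d :: 'p rel. Card_order d \<and> \<not> is_fine d P r \<longrightarrow> c \<le>o d))"
    using assms(2) by (simp only: fi_def if_True)
  note * = ex[folded fi, THEN conjunct1] ex[folded fi, THEN conjunct2, THEN conjunct1]
    ex[folded fi, THEN conjunct2, THEN conjunct2, rule_format, OF conjI]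
  show "Card_order (fi P r)" by (rule *(1))
  show "\<not> is_fine (fi P r) P r" by (rule *(2))
  assume k: "Card_order \<kappa>" "\<not> is_fine \<kappa> P r"
  show "fi P r \<le>o \<kappa>"
  proof (rule ccontr)
    assume "\<not> fi P r \<le>o \<kappa>"
    then have "\<kappa> <o fi P r"
      using not_ordLeq_iff_ordLess[OF card_order_on_well_order_on[OF k(1)]
          card_order_on_well_order_on[OF *(1)]] by simp
    then have le: "\<kappa> \<le>o fi P r" by (rule ordLess_imp_ordLeq)
    then have "|Field \<kappa>| \<le>o |Field (fi P r)|" by (rule card_of_mono2)
    then obtain g where g: "inj_on g (Field \<kappa>)" "g ` Field \<kappa> \<subseteq> Field (fi P r)"
      unfolding card_of_ordLeq[symmetric] by blast
    define A where "A = g ` Field \<kappa>"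
    have "|Field \<kappa>| =o |A|"
      unfolding A_def by (rule card_of_ordIsoI[OF inj_on_imp_bij_betw[OF g(1)]])
    then have A: "\<kappa> =o |A|"
      by (rule ordIso_transitive[OF ordIso_symmetric[OF card_of_Field_ordIso[OF k(1)]]])
    have "is_fine \<kappa> P r" if "is_fine (card_of A) P r"
      unfolding is_fine_def
    proof (intro allI impI)
      fix C assume "C \<subseteq> P" "|C| \<le>o \<kappa>"
      from this(2) have "|C| \<le>o |A|" by (rule ordLeq_ordIso_trans[OF _ A])
      with that \<open>C \<subseteq> P\<close> show "\<exists>B\<subseteq>P. countable B \<and> dominated_by r C B"
        unfolding is_fine_def by simp
    qed
    with k(2) have "\<not> is_fine (card_of A) P r" by auto
    then have "fi P r \<le>o |A|" by (rule *(3)[OF card_of_Card_order])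
    then have "fi P r \<le>o \<kappa>" by (rule ordLeq_ordIso_trans[OF _ ordIso_symmetric[OF A]])
    with \<open>\<not> fi P r \<le>o \<kappa>\<close> show False ..
  qed
qed

end

theory Submission
  imports Defs "HOL-Library.Countable_Set_Type"
begin

text \<open>A monotone map \<open>f\<close> from \<open>P\<close> with cofinal image in the
  neighbourhood filter carries cofinal sets to neighbourhood bases, which bounds the character by
  \<open>cof P r\<close> (\<open>cof_le_of_cofinal_map\<close>). For the lower bound, let the
  character be uncountable and lift a base of least size through \<open>f\<close> to a subset of
  \<open>P\<close>. If a countable set dominated this lift, its image would be a countable base,
  which is impossible. Hence \<open>P\<close> is not fine for the character
  (\<open>not_is_fine_cof\<close>), and minimality of \<open>fi P r\<close> applies.\<close>

lemma preorder_on_nbhds0: "preorder_on (nbhds0 G) (nbhds0_rel G)"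
  by (auto simp: preorder_on_def refl_on_def nbhds0_rel_def intro!: transI)

lemma Int_in_nbhds0: "U \<in> nbhds0 G \<Longrightarrow> V \<in> nbhds0 G \<Longrightarrow> U \<inter> V \<in> nbhds0 G"
proof -
  assume "U \<in> nbhds0 G" "V \<in> nbhds0 G"
  then obtain U' V' where "open U'" "0 \<in> U'" "U' \<subseteq> U" "open V'" "0 \<in> V'" "V' \<subseteq> V"
    unfolding nbhds0_def by blast
  then have "open (U' \<inter> V') \<and> 0 \<in> U' \<inter> V' \<and> U' \<inter> V' \<subseteq> U \<inter> V"
    by auto
  then show ?thesis
    unfolding nbhds0_def by blast
qed

text \<open>This makes \<open>cof_directed_cases\<close> available for the character: it is 1,
  \<omega> or uncountable.\<close>

lemma directed_on_nbhds0: "directed_on (nbhds0 G) (nbhds0_rel G)"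
proof -
  have "UNIV \<in> nbhds0 G"
    by (auto simp: nbhds0_def)
  moreover have "\<exists>W\<in>nbhds0 G. (U, W) \<in> nbhds0_rel G \<and> (V, W) \<in> nbhds0_rel G"
    if "U \<in> nbhds0 G" "V \<in> nbhds0 G" for U V
    using that Int_in_nbhds0[OF that] by (intro bexI[of _ "U \<inter> V"]) (auto simp: nbhds0_rel_def)
  ultimately show ?thesis
    unfolding directed_on_def by blast
qed

text \<open>Monotonicity turns domination of \<open>A\<close> by \<open>B\<close> into domination of
  \<open>f\<close> A\<open>by\<close>f \<open>B\<close>, and transitivity does the rest. Both bounds
  rest on this: the upper one with \<open>A = P\<close> and \<open>B\<close> cofinal, the lower one
  with \<open>A\<close> a lifted base and \<open>B\<close> countable.\<close>

lemma cofinal_in_monotone_image: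
  assumes "trans s" "f ` P \<subseteq> Q"
    and "\<And>p q. p \<in> P \<Longrightarrow> q \<in> P \<Longrightarrow> (p, q) \<in> r \<Longrightarrow> (f p, f q) \<in> s"
    and "A \<subseteq> P" "cofinal_in Q s (f ` A)" "B \<subseteq> P" "dominated_by r A B"
  shows "cofinal_in Q s (f ` B)"
proof -
  have "\<exists>b\<in>B. (u, f b) \<in> s" if "u \<in> Q" for u
  proof -
    have "\<exists>c\<in>f ` A. (u, c) \<in> s"
      using assms(5) that by (simp only: cofinal_in_def dominated_by_def)
    then obtain a where a: "a \<in> A" "(u, f a) \<in> s"
      by (elim bexE imageE) simp
    then obtain b where b: "b \<in> B" "(a, b) \<in> r"
      using assms(7) by (auto simp: dominated_by_def)
    then have "(f a, f b) \<in> s"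
      using a(1) assms(4,6) by (intro assms(3)) auto
    with a(2) b(1) show ?thesis
      using transD[OF assms(1)] by (intro bexI[of _ b])
  qed
  moreover have "f ` B \<subseteq> Q"
    using assms(2,6) by (meson image_mono order_trans)
  ultimately show ?thesis
    by (simp add: cofinal_in_def dominated_by_def)
qed

lemma cof_le_of_cofinal_map:
  assumes "preorder_on P r" "preorder_on Q s" "f ` P \<subseteq> Q"
    and "\<And>p q. p \<in> P \<Longrightarrow> q \<in> P \<Longrightarrow> (p, q) \<in> r \<Longrightarrow> (f p, f q) \<in> s"
    and "cofinal_in Q s (f ` P)"
  shows "cof Q s \<le>o cof P r"
proof -
  obtain A where A: "cofinal_in P r A" "cof P r = |A|"
    using cof_least(1)[OF assms(1)] by blast
  have tr: "trans s"
    using assms(2) by (simp add: preorder_on_def)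
  have "A \<subseteq> P" "dominated_by r P A"
    using A(1) by (auto simp: cofinal_in_def)
  then have "cofinal_in Q s (f ` A)"
    using cofinal_in_monotone_image[OF tr assms(3,4) order_refl assms(5)] by blast
  then have "cof Q s \<le>o |f ` A|"
    by (rule cof_least(2)[OF assms(2)])
  then show ?thesis
    unfolding A(2) by (rule ordLeq_transitive[OF _ card_of_image])
qed

lemma not_is_fine_cof:
  assumes "preorder_on Q s" "f ` P \<subseteq> Q"
    and "\<And>p q. p \<in> P \<Longrightarrow> q \<in> P \<Longrightarrow> (p, q) \<in> r \<Longrightarrow> (f p, f q) \<in> s"
    and "cofinal_in Q s (f ` P)" "natLeq <o cof Q s"
  shows "\<not> is_fine (cof Q s) P r"
proof
  assume fine: "is_fine (cof Q s) P r"
  obtain D where D: "cofinal_in Q s D" "cof Q s = |D|"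
    using cof_least(1)[OF assms(1)] by blast
  have tr: "trans s"
    using assms(1) by (simp add: preorder_on_def)
  have "\<forall>d\<in>D. \<exists>p\<in>P. (d, f p) \<in> s"
    using D(1) assms(4) by (fastforce simp: cofinal_in_def dominated_by_def)
  then obtain g where g: "\<And>d. d \<in> D \<Longrightarrow> g d \<in> P \<and> (d, f (g d)) \<in> s"
    by metis
  have "\<exists>d\<in>D. (u, f (g d)) \<in> s" if "u \<in> Q" for u
    using D(1) that g tr unfolding cofinal_in_def dominated_by_def by (meson transD)
  then have cof_gD: "cofinal_in Q s (f ` g ` D)"
    using g assms(2) by (auto simp: cofinal_in_def dominated_by_def)
  have gD: "g ` D \<subseteq> P"
    using g by auto
  have "|g ` D| \<le>o cof Q s"
    unfolding D(2) by (rule card_of_image)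
  then obtain B where B: "B \<subseteq> P" "countable B" "dominated_by r (g ` D) B"
    using fine[unfolded is_fine_def, rule_format, OF gD] by metis
  \<comment> \<open>A countable cofinal set in \<open>Q\<close>, against the uncountable
    cofinality.\<close>
  have "cofinal_in Q s (f ` B)"
    using cofinal_in_monotone_image[OF tr assms(2,3) gD cof_gD B(1,3)] by blast
  then have "cof Q s \<le>o |f ` B|"
    by (rule cof_least(2)[OF assms(1)])
  moreover have "|f ` B| \<le>o natLeq"
    using B(2) by (simp add: countable_card_le_natLeq[symmetric])
  ultimately show False
    using not_ordLess_ordLeq[OF assms(5)] ordLeq_transitive by blast
qed

theorem theorem2p7:
  fixes P :: "'p set" and r :: "'p rel"
  assumes "partial_order_on P r" and "directed_on P r"
    and "has_base TYPE('g::{topological_group_add, t2_space}) P r"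
  shows "character TYPE('g) =o |{()}| \<or> character TYPE('g) =o natLeq \<or>
         (fi P r \<le>o character TYPE('g) \<and> character TYPE('g) \<le>o cof P r)"
proof -
  let ?Q = "nbhds0 TYPE('g)" and ?s = "nbhds0_rel TYPE('g)"
  have P: "preorder_on P r"
    using assms(1) by (simp add: partial_order_on_def)
  obtain f where f: "f ` P \<subseteq> ?Q" "cofinal_in ?Q ?s (f ` P)"
    "\<And>p q. p \<in> P \<Longrightarrow> q \<in> P \<Longrightarrow> (p, q) \<in> r \<Longrightarrow> (f p, f q) \<in> ?s"
    using assms(3) unfolding has_base_def by blast
  have le: "cof ?Q ?s \<le>o cof P r"
    using cof_le_of_cofinal_map[OF P preorder_on_nbhds0 f(1,3,2)] .
  have "fi P r \<le>o cof ?Q ?s" if unc: "natLeq <o cof ?Q ?s"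
  \<comment> \<open>The character is a cardinal on sets of group elements, while
    \<open>fi P r\<close> lives on the type of \<open>P\<close>; \<open>fi_least\<close> gives
    minimality across types.\<close>
  proof (rule fi_least(3)[OF P])
    \<comment> \<open>Uncountability passes up from the character, so \<open>fi P r\<close> is
      indeed the least cardinal for which fineness fails.\<close>
    show "natLeq <o cof P r"
      using unc le by (rule ordLess_ordLeq_trans)
    show "Card_order (cof ?Q ?s)"
      using cof_least(1)[OF preorder_on_nbhds0[of "TYPE('g)"]] card_of_Card_order by metis
    show "\<not> is_fine (cof ?Q ?s) P r"
      using not_is_fine_cof[OF preorder_on_nbhds0 f(1,3,2) unc] .
  qed
  then show ?thesis
    using cof_directed_cases[OF preorder_on_nbhds0 directed_on_nbhds0, of "TYPE('g)"] le
    unfolding character_def by blast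
qed

end
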